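(* Let $m,n,k\in\mathbb{Z}$ with $m\ge n\ge0$ and $-k\notin\{0,1,\ldots,m\}$. Then \[P_{n,-k}=k\binom{m+k}{m}\sum_{j=0}^m(-1)^j\frac{1}{k+j}\binom mj P_{n,j}.\]
   Context: $\mathbb{K}$ is a field of characteristic zero; for integers $N$ and $m\ge0$, $\binom Nm=N(N-1)\cdots(N-m+1)/m!$. Partial Bell polynomials: $B_{0,0}=1$, $B_{n,0}=0$ ($n\ge1$), $B_{n,j}=0$ ($j>n$), and for $1\le j\le n$, $B_{n,j}=\sum\frac{n!}{\prod_ir_i!(i!)^{r_i}}\prod_iX_i^{r_i}$ over non-negative integers $r_i$ with $\sum r_i=j$, $\sum ir_i=n$. The potential polynomials are $P_{n,r}:=\sum_{j=0}^n r(r-1)\cdots(r-j+1)\,B_{n,j}\in\mathbb{K}[X_1,\ldots,X_n]$ for $n\ge0$, $r\in\mathbb{Z}$. *)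

theory Defs
  imports Complex_Main "HOL-Library.Poly_Mapping"
begin

text \<open>Polynomials over \<open>'a\<close> in the variables \<open>X\<^sub>0, X\<^sub>1, X\<^sub>2, \<dots>\<close>: finitely supported maps from
  monomials (exponent vectors) to coefficients, with the convolution product of
  \<^theory>\<open>HOL-Library.Poly_Mapping\<close>. All the rings \<open>K[X\<^sub>1, \<dots>, X\<^sub>n]\<close> are subrings of this one;
  \<open>X\<^sub>0\<close> is never used.\<close>

type_synonym 'a mpol = "(nat \<Rightarrow>\<^sub>0 nat) \<Rightarrow>\<^sub>0 'a"

definition Var :: "nat \<Rightarrow> 'a::comm_ring_1 mpol" where
  "Var i = Poly_Mapping.single (Poly_Mapping.single i 1) 1"

definition Const :: "'a::comm_ring_1 \<Rightarrow> 'a mpol" where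
  "Const c = Poly_Mapping.single 0 c"

text \<open>The constraint \<open>\<Sum>i. i r\<^sub>i = n\<close> forces \<open>r\<^sub>i = 0\<close> for \<open>i > n\<close>, so the index may be restricted to
  \<open>1 \<le> i \<le> n\<close>; fixing \<open>r\<close> to be \<open>0\<close> elsewhere makes each family occur exactly once.\<close>

definition bell_index :: "nat \<Rightarrow> nat \<Rightarrow> (nat \<Rightarrow> nat) set" where
  "bell_index n j = {r. (\<forall>i. i \<notin> {1..n} \<longrightarrow> r i = 0) \<and>
     (\<Sum>i=1..n. r i) = j \<and> (\<Sum>i=1..n. i * r i) = n}"

lemma finite_bell_index: "finite (bell_index n j)"
proof (rule finite_subset)
  show "bell_index n j \<subseteq> {r. \<forall>i. (i \<in> {1..n} \<longrightarrow> r i \<in> {0..j}) \<and> (i \<notin> {1..n} \<longrightarrow> r i = 0)}"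
    by (auto simp: bell_index_def intro: member_le_sum)
  show "finite {r. \<forall>i. (i \<in> {1..n} \<longrightarrow> r i \<in> {0..j}) \<and> (i \<notin> {1..n} \<longrightarrow> r i = 0)}"
    by (rule finite_set_of_finite_funs) auto
qed

definition bell_poly :: "nat \<Rightarrow> nat \<Rightarrow> 'a::field_char_0 mpol" where
  "bell_poly n j =
    (if n = 0 \<and> j = 0 then 1
     else if j = 0 \<or> j > n then 0
     else \<Sum>r\<in>bell_index n j.
       Const (fact n / (\<Prod>i=1..n. fact (r i) * fact i ^ r i)) * (\<Prod>i=1..n. Var i ^ r i))"

definition potential_poly :: "nat \<Rightarrow> int \<Rightarrow> 'a::field_char_0 mpol" where
  "potential_poly n r =
    (\<Sum>j=0..n. Const (\<Prod>i<j. of_int r - of_nat i) * bell_poly n j)"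

end

theory Submission imports Defs begin

text \<open>Potential polynomials depend on \<open>r\<close> only through the falling factorials \<open>(r)\<^sub>l\<close> with
  \<open>l \<le> n \<le> m\<close>, so the claim is Lagrange interpolation of \<open>(r)\<^sub>l\<close> at the nodes \<open>0, \<dots>, m\<close>,
  evaluated at \<open>-k\<close>. It follows by induction on \<open>l\<close>: writing \<open>j - l = (k + j) - (k + l)\<close>, the
  first part cancels the denominator and leaves an \<open>m\<close>-th difference of a polynomial of degree
  \<open>l < m\<close>, which vanishes; the case \<open>l = 0\<close> is the partial fraction expansion of
  \<open>m! / (k (k + 1) \<cdots> (k + m))\<close>.\<close>

text \<open>Pascal's rule. Up to sign these sums are iterated differences at 0, so one difference
  can be moved onto \<open>f\<close>, which drives the inductions on \<open>m\<close> below.\<close>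

lemma alternating_binomial_sum_Suc:
  fixes f :: "nat \<Rightarrow> 'a::comm_ring_1"
  shows "(\<Sum>j\<le>Suc m. (- 1) ^ j * of_nat (Suc m choose j) * f j) =
    (\<Sum>j\<le>m. (- 1) ^ j * of_nat (m choose j) * (f j - f (Suc j)))"
proof -
  have "(\<Sum>j\<le>Suc m. (- 1) ^ j * of_nat (Suc m choose j) * f j) =
      f 0 + (\<Sum>j\<le>m. - ((- 1) ^ j * of_nat (m choose j) * f (Suc j)))
        + (\<Sum>j\<le>m. (- 1) ^ Suc j * of_nat (m choose Suc j) * f (Suc j))"
    unfolding sum.atMost_Suc_shift
    by (simp add: sum.distrib [symmetric] algebra_simps)
  \<comment> \<open>The term \<open>f 0\<close> and the last sum recombine into one sum up to
    \<open>Suc m\<close>; its top term is zero because \<open>m choose Suc m = 0\<close>.\<close>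
  also have "f 0 + (\<Sum>j\<le>m. - ((- 1) ^ j * of_nat (m choose j) * f (Suc j)))
        + (\<Sum>j\<le>m. (- 1) ^ Suc j * of_nat (m choose Suc j) * f (Suc j)) =
      (\<Sum>j\<le>Suc m. (- 1) ^ j * of_nat (m choose j) * f j)
        - (\<Sum>j\<le>m. (- 1) ^ j * of_nat (m choose j) * f (Suc j))"
    unfolding sum.atMost_Suc_shift by (simp add: sum_negf)
  also have "\<dots> = (\<Sum>j\<le>m. (- 1) ^ j * of_nat (m choose j) * (f j - f (Suc j)))"
    by (simp add: binomial_eq_0 right_diff_distrib sum_subtractf)
  finally show ?thesis .
qed

text \<open>By Pascal's rule each difference lowers the lower index \<open>l\<close> by one, so more
  than \<open>l\<close> differences leave nothing.\<close>

lemma alternating_binomial_sum_choose_eq_0: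
  assumes "l < m"
  shows "(\<Sum>j\<le>m. (- 1) ^ j * of_nat (m choose j) * of_nat (j choose l)) = (0::'a::comm_ring_1)"
  using assms
proof (induction m arbitrary: l)
  case (Suc m)
  show ?case
  proof (cases l)
    case 0
    then show ?thesis
      unfolding alternating_binomial_sum_Suc by simp
  next
    case (Suc l')
    then have "(\<Sum>j\<le>Suc m. (- 1) ^ j * of_nat (Suc m choose j) * of_nat (j choose l)) =
        - (\<Sum>j\<le>m. (- 1) ^ j * of_nat (m choose j) * of_nat (j choose l') :: 'a)"
      unfolding alternating_binomial_sum_Suc by (simp add: sum_negf)
    then show ?thesis
      using Suc.IH [of l'] Suc.prems Suc by simp
  qed
qed simp

lemma alternating_binomial_sum_inverse:
  fixes x :: "'a::field_char_0"
  assumes "pochhammer x (Suc m) \<noteq> 0"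
  shows "(\<Sum>j\<le>m. (- 1) ^ j * of_nat (m choose j) * (1 / (x + of_nat j))) =
    fact m / pochhammer x (Suc m)"
  using assms
proof (induction m arbitrary: x)
  case (Suc m)
  \<comment> \<open>\<open>p\<close> is the factor common to the products starting at
    \<open>x\<close> and at \<open>x + 1\<close>. Both divide the product assumed nonzero, so the
    induction hypothesis applies at both points.\<close>
  define p where "p = pochhammer (x + 1) m"
  have rec1: "pochhammer x (Suc m) = x * p"
    by (simp add: p_def pochhammer_rec)
  have rec2: "pochhammer (x + 1) (Suc m) = p * (x + 1 + of_nat m)"
    by (simp add: p_def pochhammer_Suc)
  have "pochhammer x (Suc (Suc m)) = x * (p * (x + 1 + of_nat m))"
    unfolding rec2 [symmetric] by (rule pochhammer_rec)
  note rec = rec1 rec2 this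
  with Suc.prems have nz: "x \<noteq> 0" "p \<noteq> 0" "x + 1 + of_nat m \<noteq> 0"
    by auto
  have "(\<Sum>j\<le>Suc m. (- 1) ^ j * of_nat (Suc m choose j) * (1 / (x + of_nat j))) =
      (\<Sum>j\<le>m. (- 1) ^ j * of_nat (m choose j) * (1 / (x + of_nat j)))
      - (\<Sum>j\<le>m. (- 1) ^ j * of_nat (m choose j) * (1 / (x + 1 + of_nat j)))"
    unfolding alternating_binomial_sum_Suc
    by (simp add: right_diff_distrib sum_subtractf add.assoc)
  also have "\<dots> = fact m / (x * p) - fact m / (p * (x + 1 + of_nat m))"
    using Suc.IH [of x] Suc.IH [of "x + 1"] nz by (simp only: rec) simp
  also have "\<dots> = fact (Suc m) / (x * (p * (x + 1 + of_nat m)))"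
  proof -
    \<comment> \<open>Over a common denominator the numerator gains the factor \<open>q - x\<close>,
      which is \<open>m + 1\<close>.\<close>
    define q where "q = x + 1 + of_nat m"
    have "fact (Suc m) = (q - x) * fact m"
      by (simp add: q_def)
    then show ?thesis
      using nz unfolding q_def [symmetric] by (simp add: field_simps)
  qed
  finally show ?case
    by (simp only: rec)
qed simp

lemma falling_factorial_interpolation:
  fixes x :: "'a::field_char_0"
  assumes nz: "pochhammer x (Suc m) \<noteq> 0" and "l \<le> m"
  shows "(\<Prod>i<l. - x - of_nat i) = pochhammer x (Suc m) / fact m *
    (\<Sum>j\<le>m. (- 1) ^ j * of_nat (m choose j) * (1 / (x + of_nat j)) * (\<Prod>i<l. of_nat j - of_nat i))"
  using \<open>l \<le> m\<close>
proof (induction l)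
  case 0
  then show ?case
    using alternating_binomial_sum_inverse [OF nz] nz by simp
next
  case (Suc l)
  define c where "c j = (- 1) ^ j * (of_nat (m choose j) :: 'a)" for j
  define F where "F j = (\<Prod>i<l. of_nat j - of_nat i :: 'a)" for j
  define C where "C = pochhammer x (Suc m) / fact m"
  \<comment> \<open>In binomial form the vanishing lemma applies: the step to
    \<open>Suc l \<le> m\<close> provides the strict bound \<open>l < m\<close>.\<close>
  have F: "F j = fact l * of_nat (j choose l)" for j
    by (simp add: F_def binomial_gbinomial gbinomial_prod_rev atLeast0LessThan)
  have "(\<Sum>j\<le>m. c j * F j) =
      fact l * (\<Sum>j\<le>m. (- 1) ^ j * of_nat (m choose j) * of_nat (j choose l))"
    unfolding sum_distrib_left F c_def by (simp add: mult_ac)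
  then have zero: "(\<Sum>j\<le>m. c j * F j) = 0"
    using Suc.prems by (simp add: alternating_binomial_sum_choose_eq_0)
  have nzj: "x + of_nat j \<noteq> 0" if "j \<le> m" for j
    using nz that by (auto simp: pochhammer_eq_0_iff eq_neg_iff_add_eq_0)
  have "(\<Sum>j\<le>m. c j * (1 / (x + of_nat j)) * (F j * (of_nat j - of_nat l))) =
      (\<Sum>j\<le>m. c j * F j - (x + of_nat l) * (c j * (1 / (x + of_nat j)) * F j))"
  proof (rule sum.cong [OF refl])
    fix j assume "j \<in> {..m}"
    then have "x + of_nat j \<noteq> 0"
      using nzj by simp
    then show "c j * (1 / (x + of_nat j)) * (F j * (of_nat j - of_nat l)) =
      c j * F j - (x + of_nat l) * (c j * (1 / (x + of_nat j)) * F j)"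
      by (simp add: field_simps)
  qed
  also have "\<dots> = (- x - of_nat l) * (\<Sum>j\<le>m. c j * (1 / (x + of_nat j)) * F j)"
    unfolding sum_subtractf zero sum_distrib_left [symmetric] by algebra
  finally have "C * (\<Sum>j\<le>m. c j * (1 / (x + of_nat j)) * (F j * (of_nat j - of_nat l))) =
      (- x - of_nat l) * (C * (\<Sum>j\<le>m. c j * (1 / (x + of_nat j)) * F j))"
    by (simp only: mult.left_commute)
  also have "\<dots> = (\<Prod>i<l. - x - of_nat i) * (- x - of_nat l)"
    using Suc by (simp add: c_def F_def C_def)
  finally show ?case
    by (simp add: c_def F_def C_def)
qed

lemma Const_mult: "Const (a * b) = Const a * Const b"
  by (simp add: Const_def mult_single)

lemma Const_sum: "Const (sum f A) = (\<Sum>i\<in>A. Const (f i))"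
  by (induction A rule: infinite_finite_induct) (simp_all add: Const_def single_add)

theorem theorem8p8:
  fixes m n :: nat and k :: int
  assumes "m \<ge> n"
    and "- k \<notin> {0..int m}"
  shows "(potential_poly n (- k) :: 'a::field_char_0 mpol) =
    Const (of_int k * (of_int (int m + k) gchoose m)) *
    (\<Sum>j=0..m. Const ((- 1) ^ j * (1 / of_int (k + int j)) * (of_nat m gchoose j)) *
      potential_poly n (int j))"
proof -
  define x where "x = (of_int k :: 'a)"
  define C where "C = of_int k * (of_int (int m + k) gchoose m :: 'a)"
  define w where "w j = (- 1) ^ j * (1 / of_int (k + int j)) * (of_nat m gchoose j :: 'a)" for j
  \<comment> \<open>Characteristic zero carries the integer hypothesis on \<open>k\<close> over to
    the field.\<close>
  have "of_int k \<noteq> (of_int (- int j) :: 'a)" if "j \<le> m" for j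
    using assms(2) that unfolding of_int_eq_iff by auto
  then have nz: "pochhammer x (Suc m) \<noteq> 0"
    by (auto simp: pochhammer_eq_0_iff x_def)
  \<comment> \<open>The binomial coefficient is \<open>pochhammer (x + 1) m / fact m\<close>; the
    factor \<open>k\<close> prepends the missing term \<open>x\<close>.\<close>
  have C: "C = pochhammer x (Suc m) / fact m"
    by (simp add: C_def x_def gbinomial_pochhammer' pochhammer_rec algebra_simps)
  have w: "w j = (- 1) ^ j * of_nat (m choose j) * (1 / (x + of_nat j))" for j
    by (simp add: w_def x_def binomial_gbinomial)
  have coeff: "(\<Prod>i<l. of_int (- k) - of_nat i) =
      C * (\<Sum>j=0..m. w j * (\<Prod>i<l. of_int (int j) - of_nat i))" if "l \<le> n" for l
    using falling_factorial_interpolation [OF nz, of l] that assms(1)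
    by (simp add: C w x_def atLeast0AtMost)
  \<comment> \<open>The weights \<open>w j\<close> do not depend on \<open>l\<close>, so one
    identity serves every Bell polynomial and the two sums can be exchanged.\<close>
  have "(potential_poly n (- k) :: 'a mpol) =
      (\<Sum>l=0..n. Const C * (\<Sum>j=0..m. Const (w j) *
        (Const (\<Prod>i<l. of_int (int j) - of_nat i) * bell_poly n l)))"
    unfolding potential_poly_def
    by (intro sum.cong refl)
      (simp only: coeff atLeastAtMost_iff Const_mult Const_sum sum_distrib_right mult.assoc)
  also have "\<dots> = Const C * (\<Sum>j=0..m. Const (w j) * potential_poly n (int j))"
    unfolding potential_poly_def sum_distrib_left by (rule sum.swap)
  finally show ?thesis
    by (simp only: C_def w_def)
qed

end
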